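(* For every positive integer $h$, the distance spectral radius of the multiplicative circulant graph $MC(2^h)$ is $$\rho(MC(2^h))=\frac{2^h(3h+1)-(-1)^h}{9}.$$
   Context: For integers $m>1$, $h>0$, $MC(m^h)$ is the graph with vertex set $\mathbb{Z}_{m^h}$ in which distinct vertices $x,y$ are adjacent iff $x-y\equiv \pm m^i \pmod{m^h}$ for some $i\in\{0,\ldots,h-1\}$. The distance spectral radius of a graph is the largest eigenvalue of its distance matrix $[d(v_i,v_j)]$ of shortest-path distances. *)

theory Defs
  imports
    "HOL-Number_Theory.Cong"
    "Jordan_Normal_Form.Spectral_Radius"
    "Graph_Theory.Pair_Digraph"
    "Graph_Theory.Shortest_Path"
begin

text \<open>
  The argument pair \<open>m\<close>, \<open>h\<close> stands for \<open>MC(m^h)\<close>. The elements of \<open>\<int>/m^h\<close> are represented by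
  their least residues \<open>0, \<dots>, m^h - 1\<close>; differences are taken in \<open>int\<close> to avoid truncation.
  The undirected graph is encoded as a loop-free symmetric digraph.
\<close>

definition MC :: "nat \<Rightarrow> nat \<Rightarrow> nat pair_pre_digraph" where
  "MC m h = \<lparr> pverts = {0..<m ^ h},
     parcs = {(x, y). x \<in> {0..<m ^ h} \<and> y \<in> {0..<m ^ h} \<and> x \<noteq> y \<and>
       (\<exists>i<h. [int x - int y = int m ^ i] (mod int m ^ h) \<or>
              [int x - int y = - (int m ^ i)] (mod int m ^ h))} \<rparr>"

lemma pair_graph_MC: "pair_graph (MC m h)"
proof
  show "finite (parcs (MC m h))"
    by (rule finite_subset[of _ "{0..<m ^ h} \<times> {0..<m ^ h}"]) (auto simp: MC_def)
  have swap: "[a - b = c] (mod n) \<longleftrightarrow> [b - a = - c] (mod n)" for a b c n :: int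
    using cong_minus_minus_iff[of "a - b" c n] by simp
  have "(y, x) \<in> parcs (MC m h)" if "(x, y) \<in> parcs (MC m h)" for x y
  proof -
    from that obtain i where "i < h" and
      "[int x - int y = int m ^ i] (mod int m ^ h) \<or>
       [int x - int y = - (int m ^ i)] (mod int m ^ h)"
      by (auto simp: MC_def)
    then have "[int y - int x = int m ^ i] (mod int m ^ h) \<or>
       [int y - int x = - (int m ^ i)] (mod int m ^ h)"
      using swap[of "int x" "int y"] by fastforce
    with \<open>i < h\<close> that show ?thesis
      by (auto simp: MC_def)
  qed
  then show "symmetric (with_proj (MC m h))"
    by (auto simp: symmetric_def arcs_ends_def arc_to_ends_def with_proj_def sym_def)
qed (auto simp: MC_def)

text \<open>
  Shortest-path distance is the library's least walk cost with unit arc weights. In a connected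
  graph this is finite, so \<open>real_of_ereal\<close> loses nothing.
\<close>

definition graph_dist :: "'a pair_pre_digraph \<Rightarrow> 'a \<Rightarrow> 'a \<Rightarrow> real" where
  "graph_dist G u v = real_of_ereal (wf_digraph.\<mu> (with_proj G) (\<lambda>_. 1) u v)"

definition distance_matrix :: "'a::linorder pair_pre_digraph \<Rightarrow> real mat" where
  "distance_matrix G =
     (let vs = sorted_list_of_set (pverts G)
      in mat (length vs) (length vs) (\<lambda>(i, j). graph_dist G (vs ! i) (vs ! j)))"

text \<open>
  The distance matrix of an undirected graph is real symmetric, so all its eigenvalues are real
  and it suffices to consider the spectrum over the reals.
\<close>

definition distance_spectral_radius :: "'a::linorder pair_pre_digraph \<Rightarrow> real" where
  "distance_spectral_radius G = Max (spectrum (distance_matrix G))"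

end

theory Submission
  imports Defs
begin

text \<open>
  Distances in \<open>MC(2^h)\<close> depend only on the difference of the endpoints, so all rows of the
  distance matrix have the same sum \<open>S\<^sub>h\<close>, which is therefore its largest eigenvalue.
  The distance \<open>w\<^sub>h(x)\<close> of \<open>x\<close> from \<open>0\<close> satisfies \<open>w\<^sub>h\<^sub>+\<^sub>1(2x) = w\<^sub>h(x)\<close> and
  \<open>w\<^sub>h\<^sub>+\<^sub>1(2x+1) = 1 + min (w\<^sub>h(x)) (w\<^sub>h(x+1))\<close>. With \<open>M\<^sub>h\<close> the sum of \<open>min (w\<^sub>h(x)) (w\<^sub>h(x+1))\<close>
  over one period, this gives \<open>S\<^sub>h\<^sub>+\<^sub>1 = S\<^sub>h + 2^h + M\<^sub>h\<close>. Neighbouring values of \<open>w\<^sub>h\<close> differ by at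
  most one, whence \<open>M\<^sub>h\<^sub>+\<^sub>1 = 2 S\<^sub>h\<close>; the resulting linear recurrence for \<open>S\<^sub>h\<close> is solved by the
  stated formula.
\<close>

section \<open>Distances from potentials\<close>

context wf_digraph
begin

lemma potential_le_length_awalk:
  fixes f :: "'a \<Rightarrow> nat"
  assumes "awalk u p v"
    and "\<And>e. e \<in> arcs G \<Longrightarrow> f (tail G e) \<le> Suc (f (head G e))"
  shows "f u \<le> length p + f v"
  using assms(1)
proof (induction p arbitrary: u)
  case Nil
  then show ?case by (simp add: awalk_Nil_iff)
next
  case (Cons e p)
  then have "e \<in> arcs G" "u = tail G e" and walk: "awalk (head G e) p v"
    by (simp_all add: awalk_Cons_iff)
  then have "f u \<le> Suc (f (head G e))"
    using assms(2) by simp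
  then show ?case
    using Cons.IH[OF walk] by simp
qed

lemma ex_awalk_length_eq_potential:
  fixes f :: "'a \<Rightarrow> nat"
  assumes "u \<in> verts G" "f v = 0"
    and descent: "\<And>x. x \<in> verts G \<Longrightarrow> x \<noteq> v \<Longrightarrow>
      \<exists>e\<in>arcs G. tail G e = x \<and> f x = Suc (f (head G e))"
  shows "\<exists>p. awalk u p v \<and> length p = f u"
  using assms(1)
proof (induction "f u" arbitrary: u)
  case 0
  then have "u = v"
    using descent[of u] by auto
  then have "awalk u [] v"
    using 0 by (simp add: awalk_Nil_iff)
  then show ?case
    using 0 by force
next
  case (Suc n)
  then have "u \<noteq> v"
    using \<open>f v = 0\<close> by auto
  then obtain e where e: "e \<in> arcs G" "tail G e = u" "f u = Suc (f (head G e))"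
    using descent Suc.prems by blast
  then obtain p where "awalk (head G e) p v" "length p = f (head G e)"
    using Suc.hyps by fastforce
  then have "awalk u (e # p) v" "length (e # p) = f u"
    using e by (simp_all add: awalk_Cons_iff)
  then show ?case by blast
qed

lemma \<mu>_unit_eq_potential:
  fixes f :: "'a \<Rightarrow> nat"
  assumes "u \<in> verts G" "f v = 0"
    and step: "\<And>e. e \<in> arcs G \<Longrightarrow> f (tail G e) \<le> Suc (f (head G e))"
    and descent: "\<And>x. x \<in> verts G \<Longrightarrow> x \<noteq> v \<Longrightarrow>
      \<exists>e\<in>arcs G. tail G e = x \<and> f x = Suc (f (head G e))"
  shows "\<mu> (\<lambda>_. 1) u v = ereal (real (f u))"
proof (rule antisym)
  have cost: "awalk_cost (\<lambda>_. 1) p = real (length p)" for p :: "'b list"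
    by (induction p) simp_all
  obtain p where "awalk u p v" "length p = f u"
    using ex_awalk_length_eq_potential[OF assms(1,2) descent] by blast
  then show "\<mu> (\<lambda>_. 1) u v \<le> ereal (real (f u))"
    using min_cost_le_walk_cost[of u p v "\<lambda>_. 1"] by (simp add: cost)
  show "ereal (real (f u)) \<le> \<mu> (\<lambda>_. 1) u v"
    unfolding \<mu>_def cost
    using potential_le_length_awalk[of u _ v f] step \<open>f v = 0\<close> by (auto intro!: INF_greatest)
qed

end

lemma graph_dist_nonneg:
  assumes "pair_wf_digraph G"
  shows "0 \<le> graph_dist G u v"
proof -
  interpret pair_wf_digraph G by (rule assms)
  have "0 \<le> \<mu> (\<lambda>_. 1) u v"
    unfolding \<mu>_def using pos_cost_pos_awalk_cost[of u _ v "\<lambda>_. 1"]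
    by (auto intro!: INF_greatest)
  then show ?thesis
    unfolding graph_dist_def by (rule real_of_ereal_pos)
qed

lemma graph_dist_eq_potential:
  fixes f :: "'a \<Rightarrow> nat"
  assumes "pair_wf_digraph G" "u \<in> pverts G" "f v = 0"
    and "\<And>x y. (x, y) \<in> parcs G \<Longrightarrow> f x \<le> Suc (f y)"
    and "\<And>x. x \<in> pverts G \<Longrightarrow> x \<noteq> v \<Longrightarrow> \<exists>y. (x, y) \<in> parcs G \<and> f x = Suc (f y)"
  shows "graph_dist G u v = real (f u)"
proof -
  interpret pair_wf_digraph G by (rule assms)
  have "\<mu> (\<lambda>_. 1) u v = ereal (real (f u))"
    by (rule \<mu>_unit_eq_potential) (use assms in force)+
  then show ?thesis
    by (simp add: graph_dist_def)
qed

section \<open>Transmission-regular graphs\<close>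

lemma eigenvalue_constant_row_sum:
  fixes A :: "'a::comm_ring_1 mat"
  assumes A: "A \<in> carrier_mat n n" and "n > 0"
    and row: "\<And>i. i < n \<Longrightarrow> (\<Sum>j<n. A $$ (i, j)) = r"
  shows "eigenvalue A r"
proof -
  let ?v = "vec n (\<lambda>_. 1 :: 'a)"
  have "?v $ 0 \<noteq> 0\<^sub>v n $ 0"
    using \<open>n > 0\<close> by simp
  then have "?v \<noteq> 0\<^sub>v n" by metis
  moreover have "A *\<^sub>v ?v = r \<cdot>\<^sub>v ?v"
    using A row by (intro eq_vecI) (auto simp: scalar_prod_def atLeast0LessThan)
  ultimately show ?thesis
    using A by (auto simp: eigenvalue_def eigenvector_def intro!: exI[of _ ?v])
qed

lemma ex_max_norm_entry:
  fixes v :: "'a::real_normed_vector vec"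
  assumes "v \<in> carrier_vec n" "v \<noteq> 0\<^sub>v n"
  obtains i where "i < n" "norm (v $ i) > 0" "\<And>j. j < n \<Longrightarrow> norm (v $ j) \<le> norm (v $ i)"
proof -
  from assms obtain l where l: "l < n" "v $ l \<noteq> 0"
    by (auto simp: vec_eq_iff)
  let ?N = "(\<lambda>j. norm (v $ j)) ` {..<n}"
  have "Max ?N \<in> ?N"
    using l(1) by (intro Max_in) auto
  then obtain i where i: "i < n" "norm (v $ i) = Max ?N" by auto
  then have max: "norm (v $ j) \<le> norm (v $ i)" if "j < n" for j
    using that by simp
  have "0 < norm (v $ l)"
    using l(2) by simp
  also have "\<dots> \<le> norm (v $ i)"
    using l(1) by (rule max)
  finally show thesis
    using i(1) max by (intro that)
qed

text \<open>Compare both sides of \<open>A v = k v\<close> in a coordinate where \<open>v\<close> has maximal norm.\<close>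
lemma norm_eigenvalue_le_row_sum:
  fixes A :: "'a::real_normed_field mat"
  assumes A: "A \<in> carrier_mat n n"
    and row: "\<And>i. i < n \<Longrightarrow> (\<Sum>j<n. norm (A $$ (i, j))) \<le> r"
    and "eigenvalue A k"
  shows "norm k \<le> r"
proof -
  from \<open>eigenvalue A k\<close> A obtain v
    where v: "v \<in> carrier_vec n" "v \<noteq> 0\<^sub>v n" "A *\<^sub>v v = k \<cdot>\<^sub>v v"
    by (auto simp: eigenvalue_def eigenvector_def)
  obtain i where i: "i < n" and pos: "norm (v $ i) > 0"
    and max: "\<And>j. j < n \<Longrightarrow> norm (v $ j) \<le> norm (v $ i)"
    using ex_max_norm_entry[OF v(1,2)] by blast
  have "k * v $ i = (A *\<^sub>v v) $ i"
    using v i by simp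
  also have "\<dots> = (\<Sum>j<n. A $$ (i, j) * v $ j)"
    using A v(1) i by (auto simp: scalar_prod_def atLeast0LessThan)
  finally have "norm k * norm (v $ i) = norm (\<Sum>j<n. A $$ (i, j) * v $ j)"
    by (simp flip: norm_mult)
  also have "\<dots> \<le> (\<Sum>j<n. norm (A $$ (i, j)) * norm (v $ i))"
    using max by (intro sum_norm_le) (auto simp: norm_mult intro!: mult_left_mono)
  also have "\<dots> = (\<Sum>j<n. norm (A $$ (i, j))) * norm (v $ i)"
    by (simp add: sum_distrib_right)
  also have "\<dots> \<le> r * norm (v $ i)"
    using row[OF i] by (intro mult_right_mono) auto
  finally show ?thesis using pos by simp
qed

lemma Max_spectrum_constant_row_sum:
  fixes A :: "real mat"
  assumes A: "A \<in> carrier_mat n n" and "n > 0"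
    and nonneg: "\<And>i j. i < n \<Longrightarrow> j < n \<Longrightarrow> A $$ (i, j) \<ge> 0"
    and row: "\<And>i. i < n \<Longrightarrow> (\<Sum>j<n. A $$ (i, j)) = r"
  shows "Max (spectrum A) = r"
proof (rule Max_eqI)
  show "finite (spectrum A)"
    using A by (rule card_finite_spectrum)
  show "r \<in> spectrum A"
    using eigenvalue_constant_row_sum[OF A \<open>n > 0\<close> row] by (simp add: spectrum_def)
  fix k assume "k \<in> spectrum A"
  moreover have "(\<Sum>j<n. norm (A $$ (i, j))) \<le> r" if "i < n" for i
    using nonneg row that by simp
  ultimately have "norm k \<le> r"
    using norm_eigenvalue_le_row_sum[OF A] by (simp add: spectrum_def)
  then show "k \<le> r" by simp
qed

definition transmission :: "'a pair_pre_digraph \<Rightarrow> 'a \<Rightarrow> real" where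
  "transmission G u = (\<Sum>v\<in>pverts G. graph_dist G u v)"

lemma distance_spectral_radius_transmission_regular:
  fixes G :: "'a::linorder pair_pre_digraph"
  assumes "pair_fin_digraph G" "pverts G \<noteq> {}"
    and regular: "\<And>u. u \<in> pverts G \<Longrightarrow> transmission G u = r"
  shows "distance_spectral_radius G = r"
proof -
  interpret pair_fin_digraph G by (rule assms)
  define vs where "vs = sorted_list_of_set (pverts G)"
  let ?n = "length vs"
  have vs: "distinct vs" "set vs = pverts G"
    by (simp_all add: vs_def)
  have matrix: "distance_matrix G = mat ?n ?n (\<lambda>(i, j). graph_dist G (vs ! i) (vs ! j))"
    by (simp add: distance_matrix_def vs_def Let_def)
  have row: "(\<Sum>j<?n. graph_dist G (vs ! i) (vs ! j)) = r" if "i < ?n" for i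
  proof -
    have "(\<Sum>j<?n. graph_dist G (vs ! i) (vs ! j)) = transmission G (vs ! i)"
      unfolding transmission_def
      by (rule sum.reindex_bij_betw[OF bij_betw_nth]) (simp_all add: vs)
    also have "\<dots> = r"
      using nth_mem[OF that] vs(2) by (intro regular) simp
    finally show ?thesis .
  qed
  have "?n > 0"
    using vs(2) assms(2) by (metis length_greater_0_conv set_empty)
  then have "Max (spectrum (distance_matrix G)) = r"
    by (intro Max_spectrum_constant_row_sum[of _ ?n])
      (simp_all add: matrix row graph_dist_nonneg pair_wf_digraph_axioms)
  then show ?thesis
    by (simp add: distance_spectral_radius_def)
qed

section \<open>Distances in multiplicative circulant graphs\<close>

definition connection_set :: "nat \<Rightarrow> nat \<Rightarrow> int set" where
  "connection_set m h = (\<Union>i<h. {int m ^ i, - (int m ^ i)})"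

lemma connection_set_Suc:
  "connection_set m (Suc h) = {1, -1} \<union> (*) (int m) ` connection_set m h"
  by (simp add: connection_set_def lessThan_Suc_eq_insert_0 image_UN)

lemma pverts_MC: "pverts (MC m h) = {..<m ^ h}"
  by (auto simp: MC_def)

lemma parcs_MC_iff:
  "(x, y) \<in> parcs (MC m h) \<longleftrightarrow> x < m ^ h \<and> y < m ^ h \<and> x \<noteq> y \<and>
     (\<exists>d\<in>connection_set m h. [int x - int y = d] (mod int m ^ h))"
  by (auto simp: MC_def connection_set_def)

lemma pair_fin_digraph_MC: "pair_fin_digraph (MC m h)"
  using pair_graph_MC[of m h] by (simp add: pair_graph_def pair_digraph_def)

lemma ex_nat_residue:
  fixes n :: nat
  assumes "n > 0"
  shows "\<exists>y<n. [int y = z] (mod int n)"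
  using assms by (intro exI[of _ "nat (z mod int n)"]) (simp add: nat_less_iff cong_def)

lemma graph_dist_MC_eqI:
  fixes w :: "int \<Rightarrow> nat"
  assumes u: "u < m ^ h" and v: "v < m ^ h"
    and cong: "\<And>x y. [x = y] (mod int m ^ h) \<Longrightarrow> w x = w y"
    and zero: "w 0 = 0"
    and step: "\<And>x d. d \<in> connection_set m h \<Longrightarrow> w x \<le> Suc (w (x - d))"
    and descent: "\<And>x. \<not> int m ^ h dvd x \<Longrightarrow> \<exists>d\<in>connection_set m h. w x = Suc (w (x - d))"
  shows "graph_dist (MC m h) u v = real (w (int u - int v))"
proof (rule graph_dist_eq_potential)
  show "pair_wf_digraph (MC m h)"
    using pair_fin_digraph_MC by (simp add: pair_fin_digraph_def)
  show "w (int x - int v) \<le> Suc (w (int y - int v))" if arc: "(x, y) \<in> parcs (MC m h)" for x y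
  proof -
    from arc obtain d where d: "d \<in> connection_set m h" "[int x - int y = d] (mod int m ^ h)"
      by (auto simp: parcs_MC_iff)
    have "[int y - int v = int x - int v - d] (mod int m ^ h)"
      using cong_diff[OF cong_refl d(2), of "int x - int v"] by simp
    from cong[OF this] show ?thesis
      using step[OF d(1), of "int x - int v"] by simp
  qed
  show "\<exists>y. (x, y) \<in> parcs (MC m h) \<and> w (int x - int v) = Suc (w (int y - int v))"
    if x: "x \<in> pverts (MC m h)" and "x \<noteq> v" for x
  proof -
    have "\<not> [x = v] (mod m ^ h)"
      using x v \<open>x \<noteq> v\<close> by (simp add: pverts_MC cong_def)
    then have "\<not> int m ^ h dvd int x - int v"
      by (simp flip: cong_iff_dvd_diff cong_int_iff)
    then obtain d where d: "d \<in> connection_set m h"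
      and less: "w (int x - int v) = Suc (w (int x - int v - d))"
      using descent by blast
    have "m ^ h > 0" using v by linarith
    then obtain y where y: "y < m ^ h" and cong_y: "[int y = int x - d] (mod int m ^ h)"
      using ex_nat_residue[of "m ^ h" "int x - d"] by auto
    have "[int x - int y = d] (mod int m ^ h)"
      using cong_diff[OF cong_refl cong_y, of "int x"] by simp
    moreover have "[int y - int v = int x - int v - d] (mod int m ^ h)"
      using cong_diff[OF cong_y cong_refl, of "int v"] by (simp add: algebra_simps)
    from cong[OF this] have "w (int x - int v) = Suc (w (int y - int v))"
      using less by simp
    moreover from this have "x \<noteq> y" by auto
    ultimately show ?thesis
      using x y d by (auto simp: parcs_MC_iff pverts_MC)
  qed
qed (simp_all add: u zero pverts_MC)

section \<open>Signed binary weight\<close>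

text \<open>
  The least number of terms \<open>\<plusminus>2 ^ i\<close> that sum to \<open>x\<close> modulo \<open>2 ^ h\<close>: an odd \<open>x = 2 * y + 1\<close>
  needs a term \<open>\<plusminus>1\<close>, and removing it leaves \<open>2 * y\<close> or \<open>2 * (y + 1)\<close>.
\<close>
fun signed_weight :: "nat \<Rightarrow> int \<Rightarrow> nat" where
  "signed_weight 0 x = 0"
| "signed_weight (Suc h) x =
     (if even x then signed_weight h (x div 2)
      else Suc (min (signed_weight h (x div 2)) (signed_weight h (x div 2 + 1))))"

declare signed_weight.simps(2) [simp del]

lemma signed_weight_even [simp]: "signed_weight (Suc h) (2 * y) = signed_weight h y"
  by (simp add: signed_weight.simps(2))

lemma signed_weight_odd [simp]:
  "signed_weight (Suc h) (2 * y + 1) = Suc (min (signed_weight h y) (signed_weight h (y + 1)))"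
  by (simp add: signed_weight.simps(2))

lemma even_odd_cases [case_names even odd]:
  fixes x :: "'a::semiring_parity"
  obtains y where "x = 2 * y" | y where "x = 2 * y + 1"
  by (meson evenE oddE)

lemma signed_weight_0 [simp]: "signed_weight h 0 = 0"
  by (induction h) (simp_all add: signed_weight.simps(2))

lemma signed_weight_minus [simp]: "signed_weight h (- x) = signed_weight h x"
proof (induction h arbitrary: x)
  case (Suc h)
  show ?case
  proof (cases x rule: even_odd_cases)
    case (even y)
    have "- x = 2 * (- y)" by (simp add: even)
    then show ?thesis by (simp only: even signed_weight_even Suc)
  next
    case (odd y)
    have "- x = 2 * (- (y + 1)) + 1" by (simp add: odd)
    moreover have "- (y + 1) + 1 = - y" by simp
    ultimately show ?thesis
      by (simp only: odd signed_weight_odd Suc min.commute)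
  qed
qed simp

lemma signed_weight_add_period: "signed_weight h (x + 2 ^ h * k) = signed_weight h x"
proof (induction h arbitrary: x)
  case (Suc h)
  show ?case
  proof (cases x rule: even_odd_cases)
    case (even y)
    have "x + 2 ^ Suc h * k = 2 * (y + 2 ^ h * k)" by (simp add: even)
    then show ?thesis by (simp only: even signed_weight_even Suc)
  next
    case (odd y)
    have "x + 2 ^ Suc h * k = 2 * (y + 2 ^ h * k) + 1" by (simp add: odd)
    moreover have "y + 2 ^ h * k + 1 = (y + 1) + 2 ^ h * k" by simp
    ultimately show ?thesis by (simp only: odd signed_weight_odd Suc)
  qed
qed simp

lemma signed_weight_cong:
  assumes "[x = y] (mod 2 ^ h)"
  shows "signed_weight h x = signed_weight h y"
  using assms signed_weight_add_period by (auto simp: cong_iff_lin)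

lemma signed_weight_add_1_le: "signed_weight h (x + 1) \<le> Suc (signed_weight h x)"
proof (induction h arbitrary: x)
  case (Suc h)
  show ?case
  proof (cases x rule: even_odd_cases)
    case (even y)
    then show ?thesis by simp
  next
    case (odd y)
    have "x + 1 = 2 * (y + 1)" by (simp add: odd)
    then have "signed_weight (Suc h) (x + 1) = signed_weight h (y + 1)"
      by (simp only: signed_weight_even)
    then show ?thesis using Suc[of y] by (simp add: odd)
  qed
qed simp

lemma signed_weight_add_power2_le: "signed_weight h (x + 2 ^ i) \<le> Suc (signed_weight h x)"
proof (induction i arbitrary: h x)
  case 0
  show ?case by (simp add: signed_weight_add_1_le)
next
  case (Suc i)
  show ?case
  proof (cases h)
    case h: (Suc h')
    show ?thesis
    proof (cases x rule: even_odd_cases)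
      case (even y)
      have "x + 2 ^ Suc i = 2 * (y + 2 ^ i)" by (simp add: even)
      then show ?thesis
        using Suc[of h' y] by (simp only: h even signed_weight_even)
    next
      case (odd y)
      have "x + 2 ^ Suc i = 2 * (y + 2 ^ i) + 1" by (simp add: odd)
      moreover have "y + 2 ^ i + 1 = (y + 1) + 2 ^ i" by simp
      ultimately have "signed_weight h (x + 2 ^ Suc i) =
          Suc (min (signed_weight h' (y + 2 ^ i)) (signed_weight h' ((y + 1) + 2 ^ i)))"
        by (simp only: h signed_weight_odd)
      also have "\<dots> \<le> Suc (signed_weight h x)"
        using Suc[of h' y] Suc[of h' "y + 1"] by (auto simp: h odd)
      finally show ?thesis .
    qed
  qed simp
qed

lemma signed_weight_diff_power2_le: "signed_weight h (x - 2 ^ i) \<le> Suc (signed_weight h x)"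
  using signed_weight_add_power2_le[of h "- x" i] signed_weight_minus[of h "x - 2 ^ i"] by simp

lemma signed_weight_step:
  assumes "d \<in> connection_set 2 h"
  shows "signed_weight h x \<le> Suc (signed_weight h (x - d))"
proof -
  from assms obtain i where "d = 2 ^ i \<or> d = - (2 ^ i)"
    by (auto simp: connection_set_def)
  then show ?thesis
    using signed_weight_add_power2_le[of h "x - d" i] signed_weight_diff_power2_le[of h "x - d" i]
    by auto
qed

lemma signed_weight_descent:
  assumes "\<not> 2 ^ h dvd x"
  shows "\<exists>d\<in>connection_set 2 h. signed_weight h x = Suc (signed_weight h (x - d))"
  using assms
proof (induction h arbitrary: x)
  case (Suc h)
  show ?case
  proof (cases x rule: even_odd_cases)
    case (even y)
    then have "\<not> 2 ^ h dvd y" using Suc.prems by simp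
    then obtain d where d: "d \<in> connection_set 2 h"
      "signed_weight h y = Suc (signed_weight h (y - d))"
      using Suc.IH by blast
    have "x - 2 * d = 2 * (y - d)" by (simp add: even)
    then have "signed_weight (Suc h) x = Suc (signed_weight (Suc h) (x - 2 * d))"
      using d(2) by (simp only: even signed_weight_even)
    then show ?thesis
      using d(1) by (auto simp: connection_set_Suc)
  next
    case (odd y)
    have "x - 1 = 2 * y" "x - (- 1) = 2 * (y + 1)" by (simp_all add: odd)
    then have "signed_weight (Suc h) (x - 1) = signed_weight h y"
      "signed_weight (Suc h) (x - (- 1)) = signed_weight h (y + 1)"
      by (simp_all only: signed_weight_even)
    then have "\<exists>d\<in>{1, -1}. signed_weight (Suc h) x = Suc (signed_weight (Suc h) (x - d))"
      by (auto simp: odd min_def)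
    then show ?thesis
      unfolding connection_set_Suc by blast
  qed
qed simp

lemma graph_dist_MC_2:
  assumes "u < 2 ^ h" "v < 2 ^ h"
  shows "graph_dist (MC 2 h) u v = real (signed_weight h (int u - int v))"
  using assms signed_weight_cong signed_weight_step signed_weight_descent
  by (intro graph_dist_MC_eqI) simp_all

section \<open>Summing signed binary weights\<close>

lemma sum_periodic_shift:
  fixes f :: "int \<Rightarrow> 'a::comm_monoid_add"
  assumes periodic: "\<And>x y. [x = y] (mod int n) \<Longrightarrow> f x = f y"
  shows "(\<Sum>j<n. f (int j + a)) = (\<Sum>j<n. f (int j))"
proof -
  define shift where "shift b j = nat ((int j + b) mod int n)" for b j
  have int_shift: "int (shift b j) = (int j + b) mod int n" if "j < n" for b j
    using that by (simp add: shift_def)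
  have shift_less: "shift b j < n" if "j < n" for b j
    using that by (simp add: shift_def nat_less_iff)
  have inverse: "shift (- b) (shift b j) = j" if "j < n" for b j
  proof -
    have "int (shift (- b) (shift b j)) = ((int j + b) mod int n + - b) mod int n"
      using that by (simp add: int_shift shift_less)
    also have "\<dots> = (int j + b + - b) mod int n"
      by (rule mod_add_left_eq)
    also have "\<dots> = int j"
      using that by simp
    finally show ?thesis by simp
  qed
  show ?thesis
  proof (rule sum.reindex_bij_witness[of _ "shift (- a)" "shift a"])
    fix j assume "j \<in> {..<n}"
    then show "f (int (shift a j)) = f (int j + a)"
      by (intro periodic) (simp add: int_shift cong_def)
  qed (use inverse inverse[of _ "- a"] shift_less in auto)
qed

lemma sum_lessThan_double:
  fixes f :: "nat \<Rightarrow> 'a::comm_monoid_add"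
  shows "(\<Sum>x<2 * n. f x) = (\<Sum>x<n. f (2 * x) + f (2 * x + 1))"
  by (induction n) (simp_all add: add.assoc)

definition signed_weight_sum :: "nat \<Rightarrow> nat" where
  "signed_weight_sum h = (\<Sum>x<2 ^ h. signed_weight h (int x))"

definition signed_weight_min_sum :: "nat \<Rightarrow> nat" where
  "signed_weight_min_sum h =
     (\<Sum>x<2 ^ h. min (signed_weight h (int x)) (signed_weight h (int x + 1)))"

lemma sum_signed_weight_shift:
  "(\<Sum>x<2 ^ h. signed_weight h (int x + a)) = signed_weight_sum h"
  unfolding signed_weight_sum_def
  by (intro sum_periodic_shift signed_weight_cong) simp

lemma signed_weight_sum_Suc:
  "signed_weight_sum (Suc h) = signed_weight_sum h + 2 ^ h + signed_weight_min_sum h"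
proof -
  let ?w = "signed_weight h"
  have "signed_weight_sum (Suc h) =
      (\<Sum>x<2 ^ h. signed_weight (Suc h) (2 * int x) + signed_weight (Suc h) (2 * int x + 1))"
    unfolding signed_weight_sum_def power_Suc sum_lessThan_double by (simp add: add.commute)
  also have "\<dots> = (\<Sum>x<2 ^ h. ?w (int x) + (1 + min (?w (int x)) (?w (int x + 1))))"
    by simp
  also have "\<dots> = signed_weight_sum h + 2 ^ h + signed_weight_min_sum h"
    unfolding sum.distrib by (simp add: signed_weight_sum_def signed_weight_min_sum_def)
  finally show ?thesis .
qed

lemma signed_weight_min_sum_Suc: "signed_weight_min_sum (Suc h) = 2 * signed_weight_sum h"
proof -
  let ?w = "signed_weight h" and ?w' = "signed_weight (Suc h)"
  have min_left: "min (?w' (2 * y)) (?w' (2 * y + 1)) = ?w y" for y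
    using signed_weight_diff_power2_le[of h "y + 1" 0] by simp
  have min_right: "min (?w' (2 * y + 1)) (?w' (2 * (y + 1))) = ?w (y + 1)" for y
    using signed_weight_add_1_le[of h y]
    by (simp only: signed_weight_even signed_weight_odd)
  have "signed_weight_min_sum (Suc h) =
      (\<Sum>x<2 ^ h. min (?w' (2 * int x)) (?w' (2 * int x + 1)) +
        min (?w' (2 * int x + 1)) (?w' (2 * (int x + 1))))"
    unfolding signed_weight_min_sum_def power_Suc sum_lessThan_double
    by (simp add: algebra_simps)
  also have "\<dots> = (\<Sum>x<2 ^ h. ?w (int x) + ?w (int x + 1))"
    by (simp only: min_left min_right)
  also have "\<dots> = 2 * signed_weight_sum h"
    by (simp add: sum.distrib sum_signed_weight_shift flip: signed_weight_sum_def)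
  finally show ?thesis .
qed

lemma signed_weight_sum_closed_form:
  "real (signed_weight_sum h) = (2 ^ h * (3 * real h + 1) - (-1) ^ h) / 9"
proof (induction h rule: induct_nat_012)
  case 0
  show ?case by (simp add: signed_weight_sum_def)
next
  case 1
  show ?case
    using signed_weight_sum_Suc[of 0]
    by (simp add: signed_weight_sum_def[of 0] signed_weight_min_sum_def[of 0])
next
  case (ge2 h)
  have "real (signed_weight_sum (Suc (Suc h))) =
      real (signed_weight_sum (Suc h)) + 2 * 2 ^ h + 2 * real (signed_weight_sum h)"
    by (simp add: signed_weight_sum_Suc[of "Suc h"] signed_weight_min_sum_Suc)
  then show ?case unfolding ge2 by (simp add: field_simps)
qed

lemma transmission_MC_2:
  assumes "u < 2 ^ h"
  shows "transmission (MC 2 h) u = real (signed_weight_sum h)"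
proof -
  have "transmission (MC 2 h) u = (\<Sum>v<2 ^ h. real (signed_weight h (int u - int v)))"
    using assms by (simp add: transmission_def pverts_MC graph_dist_MC_2)
  also have "\<dots> = real (\<Sum>v<2 ^ h. signed_weight h (int v + - int u))"
    using signed_weight_minus[of h "int u - int v" for v] by simp
  also have "\<dots> = real (signed_weight_sum h)"
    by (simp only: sum_signed_weight_shift)
  finally show ?thesis .
qed

theorem theorem3p20:
  fixes h :: nat
  assumes "h > 0"
  shows "distance_spectral_radius (MC 2 h) = (2 ^ h * (3 * real h + 1) - (-1) ^ h) / 9"
proof -
  have "distance_spectral_radius (MC 2 h) = real (signed_weight_sum h)"
  proof (rule distance_spectral_radius_transmission_regular)
    show "pair_fin_digraph (MC 2 h)"
      by (rule pair_fin_digraph_MC)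
    show "pverts (MC 2 h) \<noteq> {}"
      by (simp add: pverts_MC lessThan_empty_iff)
    show "transmission (MC 2 h) u = real (signed_weight_sum h)" if "u \<in> pverts (MC 2 h)" for u
      using that by (simp add: pverts_MC transmission_MC_2)
  qed
  also have "\<dots> = (2 ^ h * (3 * real h + 1) - (-1) ^ h) / 9"
    by (rule signed_weight_sum_closed_form)
  finally show ?thesis .
qed

end
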